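(* Every ultrametric space $\mathbf{M}$ embeds isometrically into a homogeneous ultrametric space with the same spectrum as $\mathbf{M}$.
   Context: A metric space $\mathbf{M}=(M,d)$ is ultrametric if $d(x,z)\le\max\{d(x,y),d(y,z)\}$ for all $x,y,z$. Its spectrum is $\mathrm{Spec}(\mathbf{M})=\{d(x,y):x,y\in M\}$. An isometric embedding is a distance-preserving map. A metric space is homogeneous if every isometry between finite subsets extends to a surjective isometry of the whole space onto itself. *)

theory Defs
  imports "HOL-Analysis.Analysis"
begin

locale Ultrametric_space = Metric_space +
  assumes ultrametric:
    "\<lbrakk>x \<in> M; y \<in> M; z \<in> M\<rbrakk> \<Longrightarrow> d x z \<le> max (d x y) (d y z)"

definition Spec :: "'a set \<Rightarrow> ('a \<Rightarrow> 'a \<Rightarrow> real) \<Rightarrow> real set" where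
  "Spec M d = {d x y | x y. x \<in> M \<and> y \<in> M}"

definition isometric_embedding ::
    "'a set \<Rightarrow> ('a \<Rightarrow> 'a \<Rightarrow> real) \<Rightarrow> 'b set \<Rightarrow> ('b \<Rightarrow> 'b \<Rightarrow> real) \<Rightarrow> ('a \<Rightarrow> 'b) \<Rightarrow> bool" where
  "isometric_embedding M d N e f \<longleftrightarrow>
     f ` M \<subseteq> N \<and> (\<forall>x\<in>M. \<forall>y\<in>M. e (f x) (f y) = d x y)"

definition surjective_isometry ::
    "'a set \<Rightarrow> ('a \<Rightarrow> 'a \<Rightarrow> real) \<Rightarrow> 'b set \<Rightarrow> ('b \<Rightarrow> 'b \<Rightarrow> real) \<Rightarrow> ('a \<Rightarrow> 'b) \<Rightarrow> bool" where
  "surjective_isometry M d N e f \<longleftrightarrow> isometric_embedding M d N e f \<and> f ` M = N"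

definition homogeneous :: "'a set \<Rightarrow> ('a \<Rightarrow> 'a \<Rightarrow> real) \<Rightarrow> bool" where
  "homogeneous M d \<longleftrightarrow>
     (\<forall>A B f. finite A \<and> A \<subseteq> M \<and> finite B \<and> B \<subseteq> M \<and> surjective_isometry A d B d f \<longrightarrow>
        (\<exists>g. surjective_isometry M d M d g \<and> (\<forall>x\<in>A. g x = f x)))"

end

theory Submission
  imports Defs
begin

text \<open>
  An ultrametric space whose isometry group is transitive on points is already homogeneous: to
  extend a partial isometry by one more point it suffices to find, whenever \<open>a\<close> and \<open>b\<close> have the
  same distances to a finite set, an isometry fixing that set and moving \<open>a\<close> to \<open>b\<close>, and one can
  exchange the open balls of radius \<open>d a b\<close> around \<open>a\<close> and \<open>b\<close> while fixing everything else.

  The space of functions on the positive part of the spectrum whose support is well-ordered by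
  \<open>>\<close>, with the largest argument of disagreement as distance, is transitive: permute
  the values coordinatewise. To embed \<open>M\<close> in it, well-order \<open>M\<close> and let the coordinate of \<open>x\<close> at \<open>r\<close>
  be the least element of the open ball of radius \<open>r\<close> around \<open>x\<close>, unless this is also
  the least element of the closed ball, in which case the coordinate is trivial. Along an
  increasing sequence in the support these least elements strictly decrease.
\<close>

section \<open>Transitive ultrametric spaces are homogeneous\<close>

lemma surjective_isometryD:
  assumes "surjective_isometry M d N e f"
  shows "\<And>x. x \<in> M \<Longrightarrow> f x \<in> N"
    and "\<And>x y. x \<in> M \<Longrightarrow> y \<in> M \<Longrightarrow> e (f x) (f y) = d x y"
    and "f ` M = N"
  using assms by (auto simp: surjective_isometry_def isometric_embedding_def)

text \<open>An involution is onto because each point is the image of its own image. The maps built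
  below are mostly involutions, so surjectivity comes for free.\<close>

lemma surjective_isometry_involution:
  assumes "\<And>x. x \<in> M \<Longrightarrow> f x \<in> M" "\<And>x. x \<in> M \<Longrightarrow> f (f x) = x"
    and "\<And>x y. x \<in> M \<Longrightarrow> y \<in> M \<Longrightarrow> d (f x) (f y) = d x y"
  shows "surjective_isometry M d M d f"
proof -
  have "x \<in> f ` M" if "x \<in> M" for x
    using assms(1,2)[OF that] by (metis imageI)
  then show ?thesis
    using assms by (auto simp: surjective_isometry_def isometric_embedding_def)
qed

context Ultrametric_space
begin

lemma ultrametric_eq:
  assumes "x \<in> M" "y \<in> M" "z \<in> M" "d x y < d y z"
  shows "d x z = d y z"
  using ultrametric[of x y z] ultrametric[of y x z] assms commute[of x y] by auto

text \<open>The given \<open>T\<close> need not fix any point. Only its restriction to the open ball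
  of radius \<open>d a b\<close> around \<open>a\<close> is kept, its inverse is used on the ball
  around \<open>b\<close>, and the identity elsewhere. A point equidistant from \<open>a\<close> and
  \<open>b\<close> lies in neither ball, as the balls are disjoint.\<close>

lemma isometry_exchanging_points:
  assumes T: "surjective_isometry M d M d T" and a: "a \<in> M" and Ta: "T a = b"
  obtains h where "surjective_isometry M d M d h" "h a = b"
    "\<And>x. x \<in> M \<Longrightarrow> d a x = d b x \<Longrightarrow> h x = x"
proof (cases "a = b")
  case True
  have "surjective_isometry M d M d id"
    by (rule surjective_isometry_involution) auto
  then show ?thesis using True that by auto
next
  case False
  note TM = surjective_isometryD(1)[OF T] and Td = surjective_isometryD(2)[OF T]
  have b: "b \<in> M" using TM[OF a] Ta by simp
  define t where "t = d a b"
  have t: "t > 0" using False a b by (simp add: t_def mdist_pos_less)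
  define T' where "T' = inv_into M T"
  have T'M: "T' x \<in> M" and TT': "T (T' x) = x" if "x \<in> M" for x
    using that surjective_isometryD(3)[OF T]
    by (auto simp: T'_def inv_into_into f_inv_into_f)
  have inj: "inj_on T M"
    by (metis Td inj_onI zero)
  have T'T: "T' (T x) = x" if "x \<in> M" for x
    using that inj by (simp add: T'_def)
  have T'd: "d (T' x) (T' y) = d x y" if "x \<in> M" "y \<in> M" for x y
    using Td[OF T'M[OF that(1)] T'M[OF that(2)]] that by (simp add: TT')
  have near_T: "d b (T x) = d a x" if "x \<in> M" for x
    using Td[OF a that] Ta by simp
  have near_T': "d a (T' x) = d b x" if "x \<in> M" for x
    using near_T[OF T'M[OF that]] TT'[OF that] by simp
  have disj: "\<not> d b x < t" if "x \<in> M" "d a x < t" for x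
    using ultrametric[OF a that(1) b] that commute[of b x] by (auto simp: t_def)
  \<comment> \<open>Using \<open>T'\<close> rather than \<open>T\<close> on the second ball makes
    \<open>h\<close> an involution even if \<open>T\<close> is not one.\<close>
  define h where "h x = (if d a x < t then T x else if d b x < t then T' x else x)" for x
  have hM: "h x \<in> M" if "x \<in> M" for x
    using that TM T'M by (simp add: h_def)
  have hh: "h (h x) = x" if "x \<in> M" for x
    using that disj[of x] disj[of "T x"] disj[of "T' x"] near_T near_T' TM T'M TT' T'T
    by (auto simp: h_def)
  \<comment> \<open>The distance between points of different balls is constant, so it survives the
    exchange.\<close>
  have cross: "d x y = t" if "x \<in> M" "y \<in> M" "d a x < t" "d b y < t" for x y
  proof -
    have "d x b = t"
      using ultrametric_eq[of x a b] that a b commute[of a x] by (simp add: t_def)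
    then show ?thesis
      using ultrametric_eq[of y b x] that b commute[of b y] commute[of b x] commute[of x y] by simp
  qed
  have outside_eq: "d a y = d b y" if "y \<in> M" "\<not> d a y < t" "\<not> d b y < t" for y
    using that ultrametric[OF a b that(1)] ultrametric[OF b a that(1)] commute[of a b]
    by (auto simp: t_def)
  \<comment> \<open>A point \<open>y\<close> outside both balls sees every point of either ball at
    one common distance. So moving \<open>x\<close> from one ball to the other leaves
    \<open>d x y\<close> unchanged.\<close>
  have outside: "d x y = d a y" if "x \<in> M" "y \<in> M" "d c x < t" "c \<in> {a, b}"
    "\<not> d a y < t" "\<not> d b y < t" for c x y
    using that ultrametric_eq[of x c y] a b outside_eq[of y] commute[of c x] by auto
  have hd: "d (h x) (h y) = d x y" if x: "x \<in> M" and y: "y \<in> M" for x y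
  proof -
    have out: "d (h x) y = d x y"
      if "x \<in> M" "y \<in> M" "\<not> d a y < t" "\<not> d b y < t" for x y
    proof (cases "d a x < t")
      case True
      then show ?thesis
        using outside[of x y a] outside[of "T x" y b] that near_T TM by (simp add: h_def)
    next
      case False
      then show ?thesis
        using outside[of x y b] outside[of "T' x" y a] that near_T' T'M by (simp add: h_def)
    qed
    have swap: "d (T x) (T' y) = d x y" if "x \<in> M" "y \<in> M" "d a x < t" "d b y < t" for x y
      using cross[OF that] cross[of "T' y" "T x"] that TM T'M near_T near_T' commute
      by metis
    consider "d a x < t" | "d b x < t" "\<not> d a x < t" | "\<not> d a x < t" "\<not> d b x < t"
      by blast
    then show ?thesis
    proof cases
      case 1
      consider "d a y < t" | "d b y < t" "\<not> d a y < t" | "\<not> d a y < t" "\<not> d b y < t"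
        by blast
      then show ?thesis
        by cases (use 1 x y Td swap out[OF x y] in \<open>auto simp: h_def\<close>)
    next
      case 2
      consider "d a y < t" | "d b y < t" "\<not> d a y < t" | "\<not> d a y < t" "\<not> d b y < t"
        by blast
      then show ?thesis
      proof cases
        case 1
        then show ?thesis
          using 2 x y swap[of y x] commute[of x y] commute[of "T' x" "T y"] by (simp add: h_def)
      qed (use 2 x y T'd out[OF x y] in \<open>auto simp: h_def\<close>)
    next
      case 3
      then have "h x = x" by (simp add: h_def)
      then show ?thesis
        using out[OF y x] 3 commute by metis
    qed
  qed
  have "h x = x" if "x \<in> M" "d a x = d b x" for x
    using disj[OF that(1)] that(2) by (auto simp: h_def)
  moreover have "h a = b" using t a Ta by (simp add: h_def)
  moreover have "surjective_isometry M d M d h"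
    by (rule surjective_isometry_involution) (use hM hh hd in auto)
  ultimately show ?thesis using that by blast
qed

lemma homogeneous_if_transitive:
  assumes trans: "\<And>a b. a \<in> M \<Longrightarrow> b \<in> M \<Longrightarrow> \<exists>T. surjective_isometry M d M d T \<and> T a = b"
  shows "homogeneous M d"
proof -
  \<comment> \<open>The image is allowed to be anywhere in \<open>M\<close>, so that the induction
    concerns the domain \<open>A\<close> alone.\<close>
  have ext: "\<exists>g. surjective_isometry M d M d g \<and> (\<forall>x\<in>A. g x = f x)"
    if "finite A" "A \<subseteq> M" "isometric_embedding A d M d f" for A f
    using that
  proof (induction A rule: finite_induct)
    case empty
    have "surjective_isometry M d M d id"
      by (rule surjective_isometry_involution) auto
    then show ?case by auto
  next
    case (insert a A)
    have fM: "f x \<in> M" if "x \<in> insert a A" for x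
      using insert.prems(2) that by (auto simp: isometric_embedding_def)
    have fd: "d (f x) (f y) = d x y" if "x \<in> insert a A" "y \<in> insert a A" for x y
      using insert.prems(2) that by (auto simp: isometric_embedding_def)
    have "isometric_embedding A d M d f"
      using fM fd by (auto simp: isometric_embedding_def)
    then obtain g where g: "surjective_isometry M d M d g" and gf: "\<And>x. x \<in> A \<Longrightarrow> g x = f x"
      using insert.IH insert.prems(1) by auto
    have a: "a \<in> M" using insert.prems(1) by simp
    \<comment> \<open>Pulling \<open>f a\<close> back along \<open>g\<close> gives a point
      \<open>b\<close> with the same distances to \<open>A\<close> as \<open>a\<close>. An isometry
      \<open>h\<close> moving \<open>a\<close> to \<open>b\<close> and fixing \<open>A\<close> then
      corrects \<open>g\<close> to \<open>g \<circ> h\<close>.\<close>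
    obtain b where b: "b \<in> M" "g b = f a"
      using fM[of a] surjective_isometryD(3)[OF g] by (metis imageE insertI1)
    obtain T where "surjective_isometry M d M d T" "T a = b"
      using trans[OF a b(1)] by blast
    then obtain h where h: "surjective_isometry M d M d h" "h a = b"
      and fix_h: "\<And>x. x \<in> M \<Longrightarrow> d a x = d b x \<Longrightarrow> h x = x"
      using isometry_exchanging_points[OF _ a] by metis
    have "h x = x" if x: "x \<in> A" for x
    proof (rule fix_h)
      show xM: "x \<in> M" using x insert.prems(1) by auto
      show "d a x = d b x"
        using fd[of a x] x gf[OF x] b surjective_isometryD(2)[OF g b(1) xM] by simp
    qed
    then have "\<forall>x\<in>insert a A. (g \<circ> h) x = f x"
      using h(2) b(2) gf by simp
    moreover have "(g \<circ> h) ` M = M"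
      using surjective_isometryD(3)[OF g] surjective_isometryD(3)[OF h(1)]
      by (metis image_comp)
    then have "surjective_isometry M d M d (g \<circ> h)"
      using surjective_isometryD(1,2)[OF g] surjective_isometryD(1,2)[OF h(1)]
      by (auto simp: surjective_isometry_def isometric_embedding_def)
    ultimately show ?case by blast
  qed
  show ?thesis
    unfolding homogeneous_def
  proof (intro allI impI)
    fix A B f
    assume *: "finite A \<and> A \<subseteq> M \<and> finite B \<and> B \<subseteq> M \<and> surjective_isometry A d B d f"
    then have "isometric_embedding A d M d f"
      by (auto simp: surjective_isometry_def isometric_embedding_def)
    with * show "\<exists>g. surjective_isometry M d M d g \<and> (\<forall>x\<in>A. g x = f x)"
      using ext by blast
  qed
qed

end

section \<open>Spaces of functions with dually well-ordered support\<close>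

text \<open>Well-ordering by \<open>>\<close>, phrased through maxima because the distance below is
  a largest point of disagreement.\<close>

definition dually_well_ordered :: "real set \<Rightarrow> bool" where
  "dually_well_ordered S \<longleftrightarrow> (\<forall>U. U \<subseteq> S \<and> U \<noteq> {} \<longrightarrow> (\<exists>m\<in>U. \<forall>u\<in>U. u \<le> m))"

text \<open>\<open>p\<close> is the trivial value, so the support of \<open>f\<close> is where
  \<open>f\<close> differs from \<open>p\<close>. The underlying sets are those of Hahn products,
  without any algebraic structure.\<close>

definition hahn_space :: "'b \<Rightarrow> real set \<Rightarrow> (real \<Rightarrow> 'b) set" where
  "hahn_space p R = {f. {r. f r \<noteq> p} \<subseteq> R \<and> dually_well_ordered {r. f r \<noteq> p}}"

text \<open>The absolute value matters only for junk: the locale of metric spaces demands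
  nonnegative distances outside the carrier as well, where the maximum may not exist.\<close>

definition hahn_dist :: "(real \<Rightarrow> 'b) \<Rightarrow> (real \<Rightarrow> 'b) \<Rightarrow> real" where
  "hahn_dist f g = (if f = g then 0 else \<bar>GREATEST r. f r \<noteq> g r\<bar>)"

lemma dually_well_ordered_subset:
  "dually_well_ordered S \<Longrightarrow> S' \<subseteq> S \<Longrightarrow> dually_well_ordered S'"
  unfolding dually_well_ordered_def by (meson order_trans)

lemma dually_well_ordered_Un:
  assumes "dually_well_ordered S" "dually_well_ordered S'"
  shows "dually_well_ordered (S \<union> S')"
  unfolding dually_well_ordered_def
proof (intro allI impI)
  fix U assume U: "U \<subseteq> S \<union> S' \<and> U \<noteq> {}"
  have max1: "U \<inter> S = {} \<or> (\<exists>m\<in>U \<inter> S. \<forall>u\<in>U \<inter> S. u \<le> m)"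
    using assms(1) unfolding dually_well_ordered_def by (meson inf_le2)
  have max2: "U \<inter> S' = {} \<or> (\<exists>m\<in>U \<inter> S'. \<forall>u\<in>U \<inter> S'. u \<le> m)"
    using assms(2) unfolding dually_well_ordered_def by (meson inf_le2)
  show "\<exists>m\<in>U. \<forall>u\<in>U. u \<le> m"
  proof (cases "U \<inter> S = {} \<or> U \<inter> S' = {}")
    case True
    then show ?thesis using max1 max2 U by blast
  next
    case False
    then obtain m m' where m: "m \<in> U" "\<forall>u\<in>U \<inter> S. u \<le> m" and m': "m' \<in> U" "\<forall>u\<in>U \<inter> S'. u \<le> m'"
      using max1 max2 by blast
    have "max m m' \<in> U" using m m' by (simp add: max_def)
    moreover have "u \<le> max m m'" if "u \<in> U" for u
      using that U m(2) m'(2) by (meson IntI UnE le_max_iff_disj subsetD)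
    ultimately show ?thesis by blast
  qed
qed

lemma hahn_dist_eqI:
  assumes "0 < r" "f r \<noteq> g r" "\<And>s. s > r \<Longrightarrow> f s = g s"
  shows "hahn_dist f g = r"
proof -
  have "(GREATEST r. f r \<noteq> g r) = r"
    by (rule Greatest_equality) (use assms in \<open>auto simp: not_less[symmetric]\<close>)
  then show ?thesis using assms by (auto simp: hahn_dist_def)
qed

text \<open>Two functions can disagree only on the union of their supports, which is again dually
  well-ordered. Hence there is a largest disagreement, and it is positive because it lies in
  \<open>R\<close>.\<close>

lemma hahn_dist_attained:
  assumes "f \<in> hahn_space p R" "g \<in> hahn_space p R" "f \<noteq> g" "R \<subseteq> {0<..}"
  shows "hahn_dist f g \<in> R \<and> f (hahn_dist f g) \<noteq> g (hahn_dist f g)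
    \<and> (\<forall>s. f s \<noteq> g s \<longrightarrow> s \<le> hahn_dist f g)"
proof -
  let ?U = "{r. f r \<noteq> g r}"
  have sub: "?U \<subseteq> {r. f r \<noteq> p} \<union> {r. g r \<noteq> p}" by auto
  have "dually_well_ordered ({r. f r \<noteq> p} \<union> {r. g r \<noteq> p})"
    using assms(1,2) by (intro dually_well_ordered_Un) (auto simp: hahn_space_def)
  moreover have "?U \<noteq> {}" using assms(3) by auto
  ultimately obtain r where r: "r \<in> ?U" "\<forall>u\<in>?U. u \<le> r"
    using sub unfolding dually_well_ordered_def by blast
  have R: "r \<in> R" using r(1) sub assms(1,2) by (auto simp: hahn_space_def)
  have "hahn_dist f g = r"
    by (rule hahn_dist_eqI) (use R r assms(4) in \<open>auto simp: not_less[symmetric]\<close>)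
  then show ?thesis using R r by auto
qed

lemma Ultrametric_space_hahn:
  assumes R: "R \<subseteq> {0<..}"
  shows "Ultrametric_space (hahn_space p R) hahn_dist"
proof -
  let ?X = "hahn_space p R"
  have nonneg: "0 \<le> hahn_dist f g" for f g :: "real \<Rightarrow> 'a" by (simp add: hahn_dist_def)
  have zero: "hahn_dist f g = 0 \<longleftrightarrow> f = g" if "f \<in> ?X" "g \<in> ?X" for f g
    using hahn_dist_attained[OF that _ R] R by (auto simp: hahn_dist_def)
  have ultra: "hahn_dist f h \<le> max (hahn_dist f g) (hahn_dist g h)"
    if "f \<in> ?X" "g \<in> ?X" "h \<in> ?X" for f g h
  proof (cases "f = h \<or> f = g \<or> g = h")
    case True
    then show ?thesis using nonneg by (auto simp: hahn_dist_def max_def)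
  next
    case False
    \<comment> \<open>At the last disagreement of \<open>f\<close> and \<open>h\<close>, the value
      of \<open>g\<close> must differ from one of theirs.\<close>
    then have "f (hahn_dist f h) \<noteq> h (hahn_dist f h)"
      using hahn_dist_attained[OF that(1,3) _ R] by blast
    then have "f (hahn_dist f h) \<noteq> g (hahn_dist f h) \<or> g (hahn_dist f h) \<noteq> h (hahn_dist f h)"
      by auto
    then show ?thesis
      using hahn_dist_attained[OF that(1,2) _ R] hahn_dist_attained[OF that(2,3) _ R] False
      by (metis le_max_iff_disj)
  qed
  show ?thesis
  proof
    show "hahn_dist f g = hahn_dist g f" for f g :: "real \<Rightarrow> 'a"
    proof -
      have "(\<lambda>r. f r \<noteq> g r) = (\<lambda>r. g r \<noteq> f r)" by auto
      then show ?thesis unfolding hahn_dist_def by (simp only: eq_commute[of f g])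
    qed
    show "hahn_dist f h \<le> hahn_dist f g + hahn_dist g h"
      if "f \<in> ?X" "g \<in> ?X" "h \<in> ?X" for f g h
      using ultra[OF that] nonneg[of f g] nonneg[of g h] by (simp add: max_def split: if_splits)
  qed (use nonneg zero ultra in auto)
qed

text \<open>Permuting the values separately at each coordinate preserves the set of disagreements of
  two functions, hence their distance. The transposition of \<open>a r\<close> and
  \<open>b r\<close> is trivial outside the supports of \<open>a\<close> and \<open>b\<close>, so
  supports stay admissible.\<close>

lemma hahn_space_transitive:
  assumes a: "a \<in> hahn_space p R" and b: "b \<in> hahn_space p R"
  shows "\<exists>T. surjective_isometry (hahn_space p R) hahn_dist (hahn_space p R) hahn_dist T \<and> T a = b"
proof -
  define T where "T f = (\<lambda>r. Transposition.transpose (a r) (b r) (f r))" for f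
  have "T f \<in> hahn_space p R" if f: "f \<in> hahn_space p R" for f
  proof -
    let ?S = "{r. f r \<noteq> p} \<union> ({r. a r \<noteq> p} \<union> {r. b r \<noteq> p})"
    have sub: "{r. T f r \<noteq> p} \<subseteq> ?S"
      by (auto simp: T_def Transposition.transpose_def)
    have "dually_well_ordered ?S"
      using a b f by (intro dually_well_ordered_Un) (auto simp: hahn_space_def)
    then have "dually_well_ordered {r. T f r \<noteq> p}"
      using sub by (rule dually_well_ordered_subset)
    moreover have "?S \<subseteq> R" using a b f by (auto simp: hahn_space_def)
    ultimately show ?thesis using sub by (auto simp: hahn_space_def)
  qed
  moreover have TT: "T (T f) = f" for f by (simp add: T_def)
  moreover have "hahn_dist (T f) (T g) = hahn_dist f g" for f g
  proof -
    have "T f = T g \<longleftrightarrow> f = g" by (metis TT)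
    moreover have "T f r \<noteq> T g r \<longleftrightarrow> f r \<noteq> g r" for r
      unfolding T_def by (metis transpose_involutory)
    ultimately show ?thesis by (simp add: hahn_dist_def)
  qed
  ultimately have "surjective_isometry (hahn_space p R) hahn_dist (hahn_space p R) hahn_dist T"
    by (intro surjective_isometry_involution) auto
  moreover have "T a = b" by (simp add: T_def)
  ultimately show ?thesis by blast
qed

section \<open>The embedding\<close>

text \<open>\<open>lo\<close> picks least elements for a well-order of the whole type, with strict
  part \<open>lt\<close>. Enlarging a set can only lower its least element.\<close>

lemma well_ordered_choice:
  "\<exists>(lt :: ('a \<times> 'a) set) lo. wf lt \<and> trans lt \<and> (\<forall>A. A \<noteq> {} \<longrightarrow> lo A \<in> A) \<and>
    (\<forall>A B. A \<noteq> {} \<longrightarrow> A \<subseteq> B \<longrightarrow> lo B = lo A \<or> (lo B, lo A) \<in> lt)"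
proof -
  obtain r :: "('a \<times> 'a) set" where r: "well_order_on UNIV r"
    using well_order_on by blast
  define lt where "lt = r - Id"
  have wf: "wf lt" using r by (simp add: well_order_on_def lt_def)
  have "trans lt" using r
    by (simp add: lt_def well_order_on_def linear_order_on_def partial_order_on_def
        preorder_on_def trans_diff_Id)
  have tot: "x = y \<or> (x, y) \<in> lt \<or> (y, x) \<in> lt" for x y
    using r by (auto simp: lt_def well_order_on_def linear_order_on_def total_on_def)
  define lo where "lo A = (SOME z. z \<in> A \<and> (\<forall>y. (y, z) \<in> lt \<longrightarrow> y \<notin> A))" for A
  have lo: "lo A \<in> A \<and> (\<forall>y. (y, lo A) \<in> lt \<longrightarrow> y \<notin> A)" if "A \<noteq> {}" for A
  proof -
    have "\<exists>z. z \<in> A \<and> (\<forall>y. (y, z) \<in> lt \<longrightarrow> y \<notin> A)"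
      using wf that by (meson wfE_min all_not_in_conv)
    then show ?thesis unfolding lo_def by (rule someI_ex)
  qed
  have "lo B = lo A \<or> (lo B, lo A) \<in> lt" if "A \<noteq> {}" "A \<subseteq> B" for A B
    using lo[of A] lo[of B] that tot by blast
  with wf \<open>trans lt\<close> lo show ?thesis by blast
qed

context Ultrametric_space
begin

lemma mball_eq:
  assumes "x \<in> M" "y \<in> M" "d x y < r"
  shows "mball x r = mball y r"
proof -
  have "d x z < r \<longleftrightarrow> d y z < r" if "z \<in> M" for z
    using assms that ultrametric[of x y z] ultrametric[of y x z] commute[of x y] by auto
  then show ?thesis using assms by (auto simp: in_mball)
qed

lemma mcball_eq:
  assumes "x \<in> M" "y \<in> M" "d x y \<le> r"
  shows "mcball x r = mcball y r"
proof -
  have "d x z \<le> r \<longleftrightarrow> d y z \<le> r" if "z \<in> M" for z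
    using assms that ultrametric[of x y z] ultrametric[of y x z] commute[of x y] by auto
  then show ?thesis using assms by (auto simp: in_mcball)
qed

lemma embeds_in_hahn_space:
  "\<exists>(p :: 'a) F. isometric_embedding M d (hahn_space p (Spec M d - {0})) hahn_dist F"
proof -
  obtain lt and lo :: "'a set \<Rightarrow> 'a" where lo: "wf lt \<and> trans lt \<and> (\<forall>A. A \<noteq> {} \<longrightarrow> lo A \<in> A) \<and>
    (\<forall>A B. A \<noteq> {} \<longrightarrow> A \<subseteq> B \<longrightarrow> lo B = lo A \<or> (lo B, lo A) \<in> lt)"
    using well_ordered_choice by (elim exE)
  then have wf: "wf lt" and "trans lt" by simp_all
  have lo_in: "lo A \<in> A" if "A \<noteq> {}" for A
    using lo that by simp
  have lo_mono: "lo B = lo A \<or> (lo B, lo A) \<in> lt" if "A \<noteq> {}" "A \<subseteq> B" for A B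
    using lo that by blast
  define R where "R = Spec M d - {0}"
  have R_pos: "r > 0" if "r \<in> R" for r
    using that nonneg by (auto simp: R_def Spec_def less_le)
  \<comment> \<open>The coordinate at \<open>r\<close> names the open ball of \<open>x\<close>
    within its closed ball. The trivial value \<open>lo M\<close> may also occur as the least
    element of a ball; \<open>base\<close> below shows that this causes no ambiguity.\<close>
  define F where "F x r =
    (if r \<in> R \<and> lo (mball x r) \<noteq> lo (mcball x r) then lo (mball x r) else lo M)" for x r
  have F_in: "F x \<in> hahn_space (lo M) R" if x: "x \<in> M" for x
  proof -
    have "dually_well_ordered {r. F x r \<noteq> lo M}"
      unfolding dually_well_ordered_def
    proof (intro allI impI)
      fix U assume U: "U \<subseteq> {r. F x r \<noteq> lo M} \<and> U \<noteq> {}"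
      \<comment> \<open>A radius \<open>r\<close> whose ball has the lowest least element is the
        maximum of \<open>U\<close>. For a larger \<open>u\<close>, the open ball contains the
        closed ball of radius \<open>r\<close>, whose least element is already strictly below
        \<open>q\<close>.\<close>
      then obtain q where "q \<in> (\<lambda>r. lo (mball x r)) ` U"
        and min_q: "\<And>y. (y, q) \<in> lt \<Longrightarrow> y \<notin> (\<lambda>r. lo (mball x r)) ` U"
        using wfE_min'[OF wf, of "(\<lambda>r. lo (mball x r)) ` U"] by (metis image_is_empty)
      then obtain r where r: "r \<in> U" "q = lo (mball x r)" by blast
      have supp: "r > 0" "lo (mball x r) \<noteq> lo (mcball x r)"
        using U r(1) R_pos by (auto simp: F_def split: if_splits)
      have "mball x r \<noteq> {}" using x supp(1) by auto
      then have lt1: "(lo (mcball x r), lo (mball x r)) \<in> lt"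
        using lo_mono[of "mball x r" "mcball x r"] supp(2) mball_subset_mcball by metis
      have "u \<le> r" if u: "u \<in> U" for u
      proof (rule ccontr)
        assume "\<not> u \<le> r"
        then have "mcball x r \<subseteq> mball x u" by auto
        moreover have "x \<in> mcball x r" using x supp(1) by simp
        then have "mcball x r \<noteq> {}" by blast
        ultimately have "(lo (mball x u), q) \<in> lt"
          using lo_mono[of "mcball x r" "mball x u"] lt1 r(2) \<open>trans lt\<close> by (metis transD)
        then show False using min_q u by blast
      qed
      then show "\<exists>m\<in>U. \<forall>u\<in>U. u \<le> m" using r(1) by blast
    qed
    moreover have "{r. F x r \<noteq> lo M} \<subseteq> R" by (auto simp: F_def)
    ultimately show ?thesis by (simp add: hahn_space_def)
  qed
  have "hahn_dist (F x) (F y) = d x y" if x: "x \<in> M" and y: "y \<in> M" for x y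
  proof (cases "x = y")
    case True
    then show ?thesis using y by (simp add: hahn_dist_def)
  next
    case False
    let ?t = "d x y"
    have t: "?t > 0" "?t \<in> R" using x y False by (auto simp: R_def Spec_def mdist_pos_less)
    \<comment> \<open>Beyond \<open>d x y\<close>, the points \<open>x\<close> and \<open>y\<close>
      have the same open and closed balls.\<close>
    have far: "F x s = F y s" if "s > ?t" for s
      using mball_eq[OF x y that] mcball_eq[OF x y, of s] that by (simp add: F_def)
    have cb: "mcball x ?t = mcball y ?t" using mcball_eq[OF x y] by simp
    have x_in: "x \<in> mball x ?t" and y_in: "y \<in> mball y ?t" using x y t by auto
    have disj: "z \<notin> mball y ?t" if "z \<in> mball x ?t" for z
      using that ultrametric[OF x _ y, of z] commute[of y z] by auto
    have ne: "lo (mball x ?t) \<noteq> lo (mball y ?t)"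
      by (metis disj empty_iff lo_in x_in y_in)
    \<comment> \<open>The closed ball lies between the open ball and \<open>M\<close>, so if the
      outer two share their least element, it does too.\<close>
    have base: "lo (mball z ?t) = lo (mcball z ?t)"
      if z: "z \<in> mball z ?t" and eq: "lo (mball z ?t) = lo M" for z
    proof (rule ccontr)
      assume neq: "lo (mball z ?t) \<noteq> lo (mcball z ?t)"
      have "mball z ?t \<noteq> {}" "mcball z ?t \<noteq> {}" using z mball_subset_mcball by blast+
      then have "(lo (mcball z ?t), lo (mball z ?t)) \<in> lt"
        using lo_mono[OF _ mball_subset_mcball] neq by metis
      moreover have "lo M = lo (mcball z ?t) \<or> (lo M, lo (mcball z ?t)) \<in> lt"
        by (rule lo_mono[OF \<open>mcball z ?t \<noteq> {}\<close> mcball_subset_mspace])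
      ultimately have "(lo M, lo M) \<in> lt" using eq neq \<open>trans lt\<close> by (metis transD)
      then show False using wf by (meson wf_not_refl)
    qed
    \<comment> \<open>If both coordinates are set by their open balls, \<open>ne\<close> separates
      them. If both are defaults, both open balls share the least element of the common closed ball,
      against \<open>ne\<close>. In the mixed case \<open>base\<close> excludes equality.\<close>
    have "F x ?t \<noteq> F y ?t"
      using t(2) ne base[OF x_in] base[OF y_in] unfolding F_def cb by metis
    then show ?thesis using hahn_dist_eqI[of ?t "F x" "F y"] t(1) far by blast
  qed
  then have "isometric_embedding M d (hahn_space (lo M) R) hahn_dist F"
    using F_in by (auto simp: isometric_embedding_def)
  then show ?thesis unfolding R_def by blast
qed

end

theorem theorem5:
  fixes M :: "'a set" and d :: "'a \<Rightarrow> 'a \<Rightarrow> real"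
  assumes "Ultrametric_space M d"
  shows "\<exists>(N :: (real \<Rightarrow> 'a) set) (e :: (real \<Rightarrow> 'a) \<Rightarrow> (real \<Rightarrow> 'a) \<Rightarrow> real) (f :: 'a \<Rightarrow> real \<Rightarrow> 'a).
           Ultrametric_space N e \<and> homogeneous N e \<and> Spec N e = Spec M d \<and>
           isometric_embedding M d N e f"
proof (cases "M = {}")
  \<comment> \<open>The function space always contains the constant function \<open>p\<close> and so
    has 0 in its spectrum. The empty space therefore needs its own target.\<close>
  case True
  have "Ultrametric_space ({} :: (real \<Rightarrow> 'a) set) (\<lambda>_ _. 0)"
    by unfold_locales auto
  moreover from this have "homogeneous ({} :: (real \<Rightarrow> 'a) set) (\<lambda>_ _. 0)"
    by (rule Ultrametric_space.homogeneous_if_transitive) auto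
  moreover have "Spec ({} :: (real \<Rightarrow> 'a) set) (\<lambda>_ _. 0) = Spec M d"
    using True by (simp add: Spec_def)
  moreover have "isometric_embedding M d ({} :: (real \<Rightarrow> 'a) set) (\<lambda>_ _. 0) f" for f
    using True by (simp add: isometric_embedding_def)
  ultimately show ?thesis by blast
next
  case False
  interpret Ultrametric_space M d by fact
  define R where "R = Spec M d - {0}"
  have R: "R \<subseteq> {0<..}" using nonneg by (auto simp: R_def Spec_def less_le)
  obtain p :: 'a and F where F: "isometric_embedding M d (hahn_space p R) hahn_dist F"
    using embeds_in_hahn_space unfolding R_def by blast
  have U: "Ultrametric_space (hahn_space p R) hahn_dist"
    by (rule Ultrametric_space_hahn[OF R])
  have "homogeneous (hahn_space p R) hahn_dist"
    using U hahn_space_transitive by (rule Ultrametric_space.homogeneous_if_transitive)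
  moreover have "Spec (hahn_space p R) hahn_dist = Spec M d"
  proof
    obtain x where "x \<in> M" using False by blast
    then have "0 \<in> Spec M d" by (auto simp: Spec_def intro!: exI[of _ x])
    moreover have "hahn_dist f g = 0 \<or> hahn_dist f g \<in> R"
      if "f \<in> hahn_space p R" "g \<in> hahn_space p R" for f g
      using hahn_dist_attained[OF that _ R] by (auto simp: hahn_dist_def)
    ultimately have "hahn_dist f g \<in> Spec M d"
      if "f \<in> hahn_space p R" "g \<in> hahn_space p R" for f g
      using that by (metis DiffD1 R_def)
    then show "Spec (hahn_space p R) hahn_dist \<subseteq> Spec M d"
      by (auto simp: Spec_def[of "hahn_space p R"])
    \<comment> \<open>The embedding itself realizes every distance of \<open>M\<close>.\<close>
    show "Spec M d \<subseteq> Spec (hahn_space p R) hahn_dist"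
    proof
      fix r assume "r \<in> Spec M d"
      then obtain x y where "x \<in> M" "y \<in> M" "r = d x y" by (auto simp: Spec_def)
      then have "F x \<in> hahn_space p R" "F y \<in> hahn_space p R" "r = hahn_dist (F x) (F y)"
        using F by (auto simp: isometric_embedding_def)
      then show "r \<in> Spec (hahn_space p R) hahn_dist" unfolding Spec_def by blast
    qed
  qed
  ultimately show ?thesis using U F by blast
qed

end
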